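(* Let $X$ be a reduced Stein space with $\dim X>0$ and let $n\ge 2$. Then $e(n,\mathcal{O}(X))\ge 2$.
   Context: $\mathcal{O}(X)$ is the ring of holomorphic functions on $X$; the dimension of $X$ is the complex dimension of its smooth part $X\setminus\mathrm{Sing}(X)$. The exponential of an $n\times n$ matrix over $\mathcal{O}(X)$ is given by the exponential series. $\mathrm{Exp}_n(\mathcal{O}(X))$ is the subgroup of $\mathrm{GL}_n(\mathcal{O}(X))$ generated by the exponentials $\exp(A)$, $A\in M_n(\mathcal{O}(X))$. $e(n,\mathcal{O}(X))$ is the minimal number such that any matrix in $\mathrm{Exp}_n(\mathcal{O}(X))$ is a product of $e(n,\mathcal{O}(X))$ exponentials of matrices in $M_n(\mathcal{O}(X))$ (with value $\infty$ if there is no such number). *)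

theory Defs
  imports
    "HOL-Analysis.Analysis"
    "HOL-Library.Function_Algebras"
    "HOL-Library.Extended_Nat"
    "HOL-Algebra.Generated_Groups"
    "Jordan_Normal_Form.Matrix"
begin

section \<open>Holomorphic functions on open subsets of \<open>\<complex>\<^sup>n\<close>\<close>

text \<open>
  The dimension of the local models of a complex space varies from point to point, so \<open>\<complex>\<^sup>n\<close> is
  realised inside the type \<^typ>\<open>nat \<Rightarrow> complex\<close> (with its product topology), in the same way as
  \<^const>\<open>Euclidean_space\<close> realises \<open>\<real>\<^sup>n\<close>.
\<close>

definition Cn :: "nat \<Rightarrow> (nat \<Rightarrow> complex) set" where
  "Cn n = {z. \<forall>i\<ge>n. z i = 0}"

definition open_in_Cn :: "nat \<Rightarrow> (nat \<Rightarrow> complex) set \<Rightarrow> bool" where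
  "open_in_Cn n W \<longleftrightarrow> openin (top_of_set (Cn n)) W"

definition Cn_norm :: "nat \<Rightarrow> (nat \<Rightarrow> complex) \<Rightarrow> real" where
  "Cn_norm n v = L2_set (\<lambda>i. norm (v i)) {..<n}"

text \<open>Holomorphic means complex (Frechet) differentiable at every point of the open set \<open>W\<close>;
  the vector \<open>c\<close> consists of the partial derivatives at \<open>z\<close>.\<close>

definition holomorphic_Cn :: "nat \<Rightarrow> (nat \<Rightarrow> complex) set \<Rightarrow> ((nat \<Rightarrow> complex) \<Rightarrow> complex) \<Rightarrow> bool" where
  "holomorphic_Cn n W f \<longleftrightarrow> open_in_Cn n W \<and>
     (\<forall>z\<in>W. \<exists>c :: nat \<Rightarrow> complex.
        ((\<lambda>w. (f w - f z - (\<Sum>i<n. c i * (w i - z i))) / complex_of_real (Cn_norm n (w - z)))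
           \<longlongrightarrow> 0) (at z within W))"

section \<open>Reduced local models\<close>

definition analytic_subset :: "nat \<Rightarrow> (nat \<Rightarrow> complex) set \<Rightarrow> (nat \<Rightarrow> complex) set \<Rightarrow> bool" where
  "analytic_subset n D A \<longleftrightarrow> open_in_Cn n D \<and> A \<subseteq> D \<and>
     (\<forall>p\<in>D. \<exists>W F. open_in_Cn n W \<and> p \<in> W \<and> W \<subseteq> D \<and> finite F \<and>
        (\<forall>f\<in>F. holomorphic_Cn n W f) \<and> A \<inter> W = {z \<in> W. \<forall>f\<in>F. f z = 0})"

text \<open>Sections of the structure sheaf of the reduced model space \<open>A\<close> over a relatively open
  subset \<open>V\<close>: functions that are locally restrictions of holomorphic functions of the ambient space.
  Functions are total in HOL; only the values on \<open>V\<close> matter.\<close>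

definition model_sections ::
  "nat \<Rightarrow> (nat \<Rightarrow> complex) set \<Rightarrow> (nat \<Rightarrow> complex) set \<Rightarrow> ((nat \<Rightarrow> complex) \<Rightarrow> complex) set" where
  "model_sections n A V = {g. \<forall>p\<in>V. \<exists>W F. p \<in> W \<and> A \<inter> W \<subseteq> V \<and> holomorphic_Cn n W F \<and>
      (\<forall>z \<in> A \<inter> W. g z = F z)}"

section \<open>Reduced complex spaces\<close>

text \<open>
  The structure sheaf of a reduced complex space is a sheaf of algebras of continuous complex
  functions, so it is given by assigning to every open set \<open>U\<close> the set \<open>\<O> U\<close> of its holomorphic
  functions. A section over \<open>U\<close> is represented by all total functions extending it (first clause
  of \<open>function_sheaf\<close>). Values of \<open>\<O>\<close> at sets that are not open are irrelevant.
\<close>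

type_synonym 'a structure_sheaf = "'a set \<Rightarrow> ('a \<Rightarrow> complex) set"

definition function_sheaf :: "('a::topological_space) structure_sheaf \<Rightarrow> bool" where
  "function_sheaf \<O> \<longleftrightarrow>
     (\<forall>U f g. open U \<and> f \<in> \<O> U \<and> (\<forall>x\<in>U. g x = f x) \<longrightarrow> g \<in> \<O> U) \<and>
     (\<forall>U f. open U \<and> f \<in> \<O> U \<longrightarrow> continuous_on U f) \<and>
     (\<forall>U. open U \<longrightarrow> (\<forall>c. (\<lambda>_. c) \<in> \<O> U) \<and>
        (\<forall>f\<in>\<O> U. \<forall>g\<in>\<O> U. f + g \<in> \<O> U \<and> f * g \<in> \<O> U)) \<and>
     (\<forall>U V f. open U \<and> open V \<and> V \<subseteq> U \<and> f \<in> \<O> U \<longrightarrow> f \<in> \<O> V) \<and>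
     (\<forall>\<U> f. (\<forall>U\<in>\<U>. open U \<and> f \<in> \<O> U) \<longrightarrow> f \<in> \<O> (\<Union>\<U>))"

text \<open>An isomorphism of the open subspace \<open>U\<close> with the model space \<open>A\<close>, \<open>\<psi>\<close> being the inverse of \<open>\<phi>\<close>.\<close>

definition model_iso :: "('a::topological_space) structure_sheaf \<Rightarrow> 'a set \<Rightarrow> nat \<Rightarrow>
    (nat \<Rightarrow> complex) set \<Rightarrow> ('a \<Rightarrow> nat \<Rightarrow> complex) \<Rightarrow> ((nat \<Rightarrow> complex) \<Rightarrow> 'a) \<Rightarrow> bool" where
  "model_iso \<O> U n A \<phi> \<psi> \<longleftrightarrow> open U \<and> homeomorphism U A \<phi> \<psi> \<and>
     (\<forall>V f. open V \<and> V \<subseteq> U \<longrightarrow> (f \<in> \<O> V \<longleftrightarrow> f \<circ> \<psi> \<in> model_sections n A (\<phi> ` V)))"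

text \<open>Complex spaces are Hausdorff and second countable.\<close>

definition reduced_complex_space ::
  "('a::{t2_space,second_countable_topology}) structure_sheaf \<Rightarrow> bool" where
  "reduced_complex_space \<O> \<longleftrightarrow> function_sheaf \<O> \<and>
     (\<forall>x. \<exists>U n D A \<phi> \<psi>. x \<in> U \<and> analytic_subset n D A \<and> model_iso \<O> U n A \<phi> \<psi>)"

definition smooth_point :: "('a::topological_space) structure_sheaf \<Rightarrow> nat \<Rightarrow> 'a \<Rightarrow> bool" where
  "smooth_point \<O> d x \<longleftrightarrow>
     (\<exists>U D \<phi> \<psi>. x \<in> U \<and> open_in_Cn d D \<and> model_iso \<O> U d D \<phi> \<psi>)"

text \<open>Dimension of the smooth part, whose components may have different dimensions.\<close>

definition complex_dim :: "('a::topological_space) structure_sheaf \<Rightarrow> enat" where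
  "complex_dim \<O> = Sup {enat d |d. \<exists>x. smooth_point \<O> d x}"

section \<open>Stein spaces\<close>

definition holomorphic_hull :: "('a::topological_space) structure_sheaf \<Rightarrow> 'a set \<Rightarrow> 'a set" where
  "holomorphic_hull \<O> K = {x. \<forall>f \<in> \<O> UNIV. norm (f x) \<le> (SUP y\<in>K. norm (f y))}"

definition reduced_stein_space ::
  "('a::{t2_space,second_countable_topology}) structure_sheaf \<Rightarrow> bool" where
  "reduced_stein_space \<O> \<longleftrightarrow> reduced_complex_space \<O> \<and>
     (\<forall>x y. x \<noteq> y \<longrightarrow> (\<exists>f \<in> \<O> UNIV. f x \<noteq> f y)) \<and>
     (\<forall>K. compact K \<and> K \<noteq> {} \<longrightarrow> compact (holomorphic_hull \<O> K))"

section \<open>Exponentials of matrices over a ring of functions\<close>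

text \<open>\<open>R\<close> is a ring of complex functions on \<^typ>\<open>'a\<close> with the pointwise operations of
  \<^theory>\<open>HOL-Library.Function_Algebras\<close>, so that \<open>n \<times> n\<close> matrices over \<open>R\<close> can be added and
  multiplied as matrices with entries of type \<^typ>\<open>'a \<Rightarrow> complex\<close>.\<close>

definition mat_over :: "nat \<Rightarrow> ('a \<Rightarrow> complex) set \<Rightarrow> ('a \<Rightarrow> complex) mat set" where
  "mat_over n R = {A \<in> carrier_mat n n. elements_mat A \<subseteq> R}"

definition GL_over :: "nat \<Rightarrow> ('a \<Rightarrow> complex) set \<Rightarrow> ('a \<Rightarrow> complex) mat monoid" where
  "GL_over n R = units_of \<lparr>carrier = mat_over n R, mult = (*), one = 1\<^sub>m n\<rparr>"

text \<open>The exponential series, summed entrywise and at every point of \<^typ>\<open>'a\<close>.\<close>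

definition mat_exp :: "('a \<Rightarrow> complex) mat \<Rightarrow> ('a \<Rightarrow> complex) mat" where
  "mat_exp A = mat (dim_row A) (dim_row A)
     (\<lambda>(i, j) x. \<Sum>k. ((A ^\<^sub>m k) $$ (i, j)) x / fact k)"

definition Exp_group :: "nat \<Rightarrow> ('a \<Rightarrow> complex) set \<Rightarrow> ('a \<Rightarrow> complex) mat set" where
  "Exp_group n R = generate (GL_over n R) (mat_exp ` mat_over n R)"

definition product_of_exps ::
  "nat \<Rightarrow> ('a \<Rightarrow> complex) set \<Rightarrow> nat \<Rightarrow> ('a \<Rightarrow> complex) mat \<Rightarrow> bool" where
  "product_of_exps n R m M \<longleftrightarrow>
     (\<exists>As. length As = m \<and> set As \<subseteq> mat_over n R \<and>
        M = foldr (\<lambda>A P. mat_exp A * P) As (1\<^sub>m n))"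

text \<open>The infimum of the empty set in \<^typ>\<open>enat\<close> is \<open>\<infinity>\<close>.\<close>

definition exp_number :: "nat \<Rightarrow> ('a \<Rightarrow> complex) set \<Rightarrow> enat" where
  "exp_number n R = Inf {enat m |m. \<forall>M \<in> Exp_group n R. product_of_exps n R m M}"

end

theory Submission
  imports Defs
begin

text \<open>
  One exponential does not suffice because a continuous logarithm of a suitable product of two
  exponentials would yield a continuous integer-valued function that takes different values at
  two points of a connected set. Let \<open>h\<close> be a global holomorphic function that is not constant on
  some compact connected set \<open>K\<close>; rescale it to \<open>g\<close> with \<open>g p = 0\<close> and \<open>g q = 2 \<pi> \<i>\<close> for two points \<open>p, q\<close> of \<open>K\<close>. For
  \<open>n = 2\<close> take
  \<open>M = exp (diag (g, 0)) exp E\<close>, where \<open>E\<close> is the elementary matrix with entry 1 in the upper right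
  corner, so that \<open>M\<close> has rows \<open>(e\<^sup>g, e\<^sup>g)\<close> and \<open>(0, 1)\<close>.

  Suppose \<open>M = exp C\<close>. At every point \<open>C\<close> commutes with \<open>M\<close>, which forces \<open>C\<close> to be upper
  triangular with diagonal entries \<open>\<lambda>, \<lambda>'\<close> satisfying \<open>e\<^sup>\<lambda> = e\<^sup>g\<close> and \<open>e\<^sup>\<lambda>\<^sup>' = 1\<close>, and at the points
  with \<open>e\<^sup>g = 1\<close>, where \<open>M\<close> is a nontrivial Jordan block, it also forces \<open>\<lambda> = \<lambda>'\<close>
  (\<open>logarithm_of_coupled_diag\<close>). Now \<open>\<lambda> - g\<close> and \<open>\<lambda>'\<close> are continuous with values in \<open>2 \<pi> \<i> \<int>\<close>,
  hence constant on \<open>K\<close> (\<open>continuous_logarithms_differ_by_constant\<close>), and so is \<open>\<lambda> - \<lambda>' - g\<close>. But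
  its value is \<open>0\<close> at \<open>p\<close> and \<open>- 2 \<pi> \<i>\<close> at \<open>q\<close>.

  For larger \<open>n\<close> the remaining diagonal entries of the first exponent are a constant \<open>c\<close>. If \<open>e\<^sup>c\<close>
  is different from 1 and from all values of \<open>e\<^sup>g\<close> on \<open>K\<close>, the additional block does not interfere
  with the computation. Such a \<open>c\<close> exists because \<open>g\<close> is bounded on the compact set \<open>K\<close>.

  The argument takes place in an algebra of continuous functions (\<open>exp_number_ge_2\<close>). The
  geometry provides \<open>K\<close> and \<open>h\<close>: a chart of positive dimension contains a segment (\<open>connected_compact_pair_in_chart\<close>), and the global functions on a Stein space
  separate its end points.
\<close>

section \<open>The exponential series of a complex matrix\<close>

definition cmat_exp :: "complex mat \<Rightarrow> complex mat" where
  "cmat_exp P = mat (dim_row P) (dim_row P) (\<lambda>(i, j). \<Sum>k. (P ^\<^sub>m k) $$ (i, j) / fact k)"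

lemma cmat_exp_carrier [simp]: "P \<in> carrier_mat n n \<Longrightarrow> cmat_exp P \<in> carrier_mat n n"
  by (auto simp: cmat_exp_def)

lemma cmat_exp_index:
  "P \<in> carrier_mat n n \<Longrightarrow> i < n \<Longrightarrow> j < n \<Longrightarrow>
    cmat_exp P $$ (i, j) = (\<Sum>k. (P ^\<^sub>m k) $$ (i, j) / fact k)"
  by (auto simp: cmat_exp_def)

lemma mult_mat_index_sum:
  fixes P Q :: "'b::semiring_0 mat"
  assumes "P \<in> carrier_mat n n" "Q \<in> carrier_mat n n" "i < n" "j < n"
  shows "(P * Q) $$ (i, j) = (\<Sum>k<n. P $$ (i, k) * Q $$ (k, j))"
  using assms by (auto simp: scalar_prod_def atLeast0LessThan intro!: sum.cong)

lemma pow_mat_Suc_left: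
  fixes P :: "'b::semiring_1 mat"
  assumes "P \<in> carrier_mat n n"
  shows "P ^\<^sub>m Suc k = P * P ^\<^sub>m k"
proof (induction k)
  case 0
  then show ?case using assms by simp
next
  case (Suc k)
  have "P ^\<^sub>m Suc (Suc k) = (P * P ^\<^sub>m k) * P"
    using Suc by simp
  also have "\<dots> = P * (P ^\<^sub>m k * P)"
    using assms by (intro assoc_mult_mat) auto
  finally show ?case by simp
qed

text \<open>Crude, but enough for the exponential series of the entries to converge.\<close>

lemma norm_pow_mat_index_le:
  fixes P :: "complex mat"
  assumes P: "P \<in> carrier_mat n n" and b: "\<And>i j. i < n \<Longrightarrow> j < n \<Longrightarrow> norm (P $$ (i, j)) \<le> b"
    and ij: "i < n" "j < n"
  shows "norm ((P ^\<^sub>m k) $$ (i, j)) \<le> (real n * b) ^ k"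
  using ij
proof (induction k arbitrary: j)
  case 0
  then show ?case using P by auto
next
  case (Suc k)
  have "norm ((P ^\<^sub>m Suc k) $$ (i, j)) = norm (\<Sum>l<n. (P ^\<^sub>m k) $$ (i, l) * P $$ (l, j))"
    using P Suc.prems by (simp add: mult_mat_index_sum[of _ n] del: index_mult_mat)
  also have "\<dots> \<le> (\<Sum>l<n. (real n * b) ^ k * b)"
    unfolding norm_mult[symmetric]
    using Suc b order_trans[OF norm_ge_zero b]
    by (intro sum_norm_le) (auto simp: norm_mult intro!: mult_mono)
  also have "\<dots> = (real n * b) ^ Suc k" by simp
  finally show ?case .
qed

lemma summable_cmat_exp:
  fixes P :: "complex mat"
  assumes P: "P \<in> carrier_mat n n" and ij: "i < n" "j < n"
  shows "summable (\<lambda>k. (P ^\<^sub>m k) $$ (i, j) / fact k)"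
proof -
  define b where "b = (\<Sum>i<n. \<Sum>j<n. norm (P $$ (i, j)))"
  have b: "norm (P $$ (i, j)) \<le> b" if "i < n" "j < n" for i j
  proof -
    have "norm (P $$ (i, j)) \<le> (\<Sum>j<n. norm (P $$ (i, j)))"
      using that by (intro member_le_sum) auto
    also have "\<dots> \<le> b"
      unfolding b_def using that
      by (intro member_le_sum[of i _ "\<lambda>i. \<Sum>j<n. norm (P $$ (i, j))"]) (auto intro: sum_nonneg)
    finally show ?thesis .
  qed
  have "summable (\<lambda>k. (real n * b) ^ k / fact k)"
    using summable_exp[of "real n * b"] by (simp add: field_simps)
  then show ?thesis
    by (rule summable_comparison_test'[where N = 0])
      (use norm_pow_mat_index_le[OF P b ij] in \<open>simp add: norm_divide divide_right_mono\<close>)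
qed

text \<open>Multiplying the series by \<open>P\<close> from either side gives the series of the \<open>P ^\<^sub>m Suc k\<close> over
  \<open>fact k\<close>. Commuting with its exponential determines enough of the shape of \<open>P\<close> to apply the two
  eigenvector lemmas that follow.\<close>

lemma cmat_exp_commute:
  assumes P: "P \<in> carrier_mat n n"
  shows "P * cmat_exp P = cmat_exp P * P"
proof (rule eq_matI)
  fix i j assume "i < dim_row (cmat_exp P * P)" "j < dim_col (cmat_exp P * P)"
  then have ij: "i < n" "j < n" using P by (auto simp: cmat_exp_def)
  have s: "summable (\<lambda>k. (P ^\<^sub>m k) $$ (l, m) / fact k)" if "l < n" "m < n" for l m
    using summable_cmat_exp[OF P that] .
  have "(P * cmat_exp P) $$ (i, j) = (\<Sum>l<n. P $$ (i, l) * (\<Sum>k. (P ^\<^sub>m k) $$ (l, j) / fact k))"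
    using P ij by (simp add: mult_mat_index_sum[of _ n] cmat_exp_index del: index_mult_mat)
  also have "\<dots> = (\<Sum>l<n. \<Sum>k. P $$ (i, l) * ((P ^\<^sub>m k) $$ (l, j) / fact k))"
    using s ij by (intro sum.cong refl suminf_mult[symmetric]) auto
  also have "\<dots> = (\<Sum>k. \<Sum>l<n. P $$ (i, l) * ((P ^\<^sub>m k) $$ (l, j) / fact k))"
    using s ij by (intro suminf_sum[symmetric] summable_mult) auto
  also have "\<dots> = (\<Sum>k. (P ^\<^sub>m Suc k) $$ (i, j) / fact k)"
    unfolding pow_mat_Suc_left[OF P] using P ij
    by (simp add: mult_mat_index_sum[of _ n] sum_divide_distrib del: index_mult_mat)
  also have "\<dots> = (\<Sum>k. \<Sum>l<n. ((P ^\<^sub>m k) $$ (i, l) / fact k) * P $$ (l, j))"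
    using P ij by (simp add: mult_mat_index_sum[of _ n] sum_divide_distrib del: index_mult_mat)
  also have "\<dots> = (\<Sum>l<n. \<Sum>k. ((P ^\<^sub>m k) $$ (i, l) / fact k) * P $$ (l, j))"
    using s ij by (intro suminf_sum summable_mult2) auto
  also have "\<dots> = (\<Sum>l<n. (\<Sum>k. (P ^\<^sub>m k) $$ (i, l) / fact k) * P $$ (l, j))"
    using s ij by (intro sum.cong refl suminf_mult2[symmetric]) auto
  also have "\<dots> = (cmat_exp P * P) $$ (i, j)"
    using P ij by (simp add: mult_mat_index_sum[of _ n] cmat_exp_index del: index_mult_mat)
  finally show "(P * cmat_exp P) $$ (i, j) = (cmat_exp P * P) $$ (i, j)" .
qed (use P in \<open>auto simp: cmat_exp_def\<close>)

lemma suminf_power_over_fact: "(\<Sum>k. z ^ k / fact k) = exp (z::complex)"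
  by (simp add: exp_def scaleR_conv_of_real field_simps)

text \<open>The hypothesis says that the unit vector \<open>e\<^sub>j\<close> is an eigenvector, and the eigenvalue is
  exponentiated. The row version is the same for left eigenvectors.\<close>

lemma cmat_exp_eigencolumn:
  assumes P: "P \<in> carrier_mat n n" and j: "j < n"
    and col: "\<And>i. i < n \<Longrightarrow> i \<noteq> j \<Longrightarrow> P $$ (i, j) = 0"
  shows "i < n \<Longrightarrow> cmat_exp P $$ (i, j) = (if i = j then exp (P $$ (j, j)) else 0)"
proof -
  have "(P ^\<^sub>m k) $$ (i, j) = (if i = j then P $$ (j, j) ^ k else 0)" if "i < n" for i k
    using that
  proof (induction k arbitrary: i)
    case 0
    then show ?case using P j by auto
  next
    case (Suc k)
    have "(P ^\<^sub>m Suc k) $$ (i, j) = (\<Sum>l<n. (P ^\<^sub>m k) $$ (i, l) * P $$ (l, j))"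
      using P j Suc.prems by (simp add: mult_mat_index_sum[of _ n] del: index_mult_mat)
    also have "\<dots> = (\<Sum>l<n. if l = j then (P ^\<^sub>m k) $$ (i, j) * P $$ (j, j) else 0)"
      using col by (intro sum.cong) auto
    finally show ?case using j Suc by simp
  qed
  then show "i < n \<Longrightarrow> ?thesis"
    using P j by (simp add: cmat_exp_index suminf_power_over_fact)
qed

lemma cmat_exp_eigenrow:
  assumes P: "P \<in> carrier_mat n n" and i: "i < n"
    and row: "\<And>j. j < n \<Longrightarrow> j \<noteq> i \<Longrightarrow> P $$ (i, j) = 0"
  shows "cmat_exp P $$ (i, i) = exp (P $$ (i, i))"
proof -
  have "(P ^\<^sub>m k) $$ (i, j) = (if i = j then P $$ (i, i) ^ k else 0)" if "j < n" for j k
    using that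
  proof (induction k arbitrary: j)
    case 0
    then show ?case using P i by auto
  next
    case (Suc k)
    have "(P ^\<^sub>m Suc k) $$ (i, j) = (\<Sum>l<n. P $$ (i, l) * (P ^\<^sub>m k) $$ (l, j))"
      unfolding pow_mat_Suc_left[OF P]
      using P i Suc.prems by (simp add: mult_mat_index_sum[of _ n] del: index_mult_mat)
    also have "\<dots> = (\<Sum>l<n. if l = i then P $$ (i, i) * (P ^\<^sub>m k) $$ (i, j) else 0)"
      using row by (intro sum.cong) auto
    finally show ?case using i Suc by simp
  qed
  then show ?thesis
    using P i by (simp add: cmat_exp_index suminf_power_over_fact)
qed

section \<open>Diagonal matrices with one coupling entry\<close>

text \<open>All matrices of the construction have this shape: the two exponents, their exponentials
  and the product of these.\<close>

definition coupled_diag :: "nat \<Rightarrow> (nat \<Rightarrow> 'b) \<Rightarrow> 'b \<Rightarrow> 'b::semiring_1 mat" where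
  "coupled_diag n d a =
     mat n n (\<lambda>(i, j). (if i = j then d i else 0) + (if i = 0 \<and> j = 1 then a else 0))"

lemma coupled_diag_carrier [simp]: "coupled_diag n d a \<in> carrier_mat n n"
  by (simp add: coupled_diag_def)

lemma coupled_diag_index:
  "i < n \<Longrightarrow> j < n \<Longrightarrow> coupled_diag n d a $$ (i, j) =
     (if i = j then d i else 0) + (if i = 0 \<and> j = 1 then a else 0)"
  by (simp add: coupled_diag_def)

lemma mult_coupled_diag_index:
  fixes P :: "'b::semiring_1 mat"
  assumes "P \<in> carrier_mat n n" "n \<ge> 2" "i < n" "j < n"
  shows "(P * coupled_diag n d a) $$ (i, j) =
    P $$ (i, j) * d j + (if j = 1 then P $$ (i, 0) * a else 0)"
proof -
  have "(P * coupled_diag n d a) $$ (i, j) =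
      (\<Sum>k<n. P $$ (i, k) * coupled_diag n d a $$ (k, j))"
    using assms by (simp add: mult_mat_index_sum[of _ n] del: index_mult_mat)
  also have "\<dots> =
      (\<Sum>k<n. (if k = j then P $$ (i, j) * d j else 0) +
              (if k = 0 then if j = 1 then P $$ (i, 0) * a else 0 else 0))"
    using assms by (intro sum.cong) (auto simp: coupled_diag_index distrib_left)
  finally show ?thesis using assms by (simp add: sum.distrib)
qed

lemma coupled_diag_mult_index:
  fixes P :: "'b::semiring_1 mat"
  assumes "P \<in> carrier_mat n n" "n \<ge> 2" "i < n" "j < n"
  shows "(coupled_diag n d a * P) $$ (i, j) =
    d i * P $$ (i, j) + (if i = 0 then a * P $$ (1, j) else 0)"
proof -
  have "(coupled_diag n d a * P) $$ (i, j) =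
      (\<Sum>k<n. coupled_diag n d a $$ (i, k) * P $$ (k, j))"
    using assms by (simp add: mult_mat_index_sum[of _ n] del: index_mult_mat)
  also have "\<dots> =
      (\<Sum>k<n. (if k = i then d i * P $$ (i, j) else 0) +
              (if k = 1 then if i = 0 then a * P $$ (1, j) else 0 else 0))"
    using assms by (intro sum.cong) (auto simp: coupled_diag_index distrib_right)
  finally show ?thesis using assms by (simp add: sum.distrib)
qed

lemma cmat_exp_diag: "cmat_exp (coupled_diag n d 0) = coupled_diag n (\<lambda>i. exp (d i)) 0"
  by (rule eq_matI)
    (auto simp: cmat_exp_eigencolumn[of _ n] coupled_diag_index
      carrier_matD[OF coupled_diag_carrier] carrier_matD[OF cmat_exp_carrier[OF coupled_diag_carrier]])

text \<open>The square of the exponent vanishes, so only two terms of the series remain.\<close>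

lemma cmat_exp_elementary:
  assumes n: "n \<ge> 2"
  shows "cmat_exp (coupled_diag n (\<lambda>_. 0) 1) = coupled_diag n (\<lambda>_. 1) 1"
proof (rule eq_matI)
  let ?E = "coupled_diag n (\<lambda>_. 0) (1::complex)"
  fix i j assume "i < dim_row (coupled_diag n (\<lambda>_. 1) (1::complex))"
    "j < dim_col (coupled_diag n (\<lambda>_. 1) (1::complex))"
  then have ij: "i < n" "j < n" by (auto simp: coupled_diag_def)
  have sq: "(?E ^\<^sub>m Suc (Suc k)) $$ (i, j) = 0" if "i < n" "j < n" for i j k
    using that
  proof (induction k arbitrary: i j)
    case 0
    have "?E ^\<^sub>m Suc (Suc 0) = ?E * ?E"
      by (simp add: carrier_matD[OF coupled_diag_carrier] left_mult_one_mat[OF coupled_diag_carrier])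
    then show ?case using n 0
      by (simp add: mult_coupled_diag_index coupled_diag_index del: index_mult_mat)
  next
    case (Suc k)
    have "(?E ^\<^sub>m Suc (Suc (Suc k))) $$ (i, j) = (?E ^\<^sub>m Suc (Suc k) * ?E) $$ (i, j)"
      by simp
    also have "\<dots> = 0"
      using n Suc
      by (subst mult_coupled_diag_index[OF pow_carrier_mat[OF coupled_diag_carrier]]) auto
    finally show ?case .
  qed
  have "cmat_exp ?E $$ (i, j) = (\<Sum>k. (?E ^\<^sub>m k) $$ (i, j) / fact k)"
    using ij by (simp add: cmat_exp_index[of _ n])
  also have "\<dots> = (\<Sum>k\<in>{0, Suc 0}. (?E ^\<^sub>m k) $$ (i, j) / fact k)"
  proof (rule suminf_finite)
    fix k :: nat assume "k \<notin> {0, Suc 0}"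
    then obtain l where "k = Suc (Suc l)" by (cases k; cases "k - 1") auto
    then show "(?E ^\<^sub>m k) $$ (i, j) / fact k = 0" using sq[OF ij, of l] by simp
  qed simp
  also have "\<dots> = coupled_diag n (\<lambda>_. 1) 1 $$ (i, j)"
    using ij
    by (simp add: coupled_diag_index carrier_matD[OF coupled_diag_carrier]
        left_mult_one_mat[OF coupled_diag_carrier])
  finally show "cmat_exp ?E $$ (i, j) = coupled_diag n (\<lambda>_. 1) 1 $$ (i, j)" .
qed (auto simp: cmat_exp_def coupled_diag_def)

text \<open>Comparing entries of \<open>P exp(P) = exp(P) P\<close> shows that column 0 and row 1 of \<open>P\<close> vanish off
  the diagonal. Entry \<open>(0, 0)\<close> is the decisive one: it yields \<open>P $$ (1, 0) = 0\<close> through the coupling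
  \<open>a\<close> even where \<open>a = 1\<close>, where the eigenvalues no longer separate the first two coordinates. There
  the coupling also identifies the two diagonal entries of \<open>P\<close>, through entry \<open>(0, 1)\<close>.\<close>

lemma logarithm_of_coupled_diag:
  assumes P: "P \<in> carrier_mat n n" and n: "n \<ge> 2"
    and exp_P: "cmat_exp P = coupled_diag n (\<lambda>i. if i = 0 then a else if i = 1 then 1 else \<mu>) a"
    and a: "a \<noteq> 0" "a \<noteq> \<mu>" and \<mu>: "\<mu> \<noteq> 1"
  shows "exp (P $$ (0, 0)) = a" "exp (P $$ (1, 1)) = 1" "a = 1 \<Longrightarrow> P $$ (0, 0) = P $$ (1, 1)"
proof -
  have comm: "P $$ (i, j) * (if j = 0 then a else if j = 1 then 1 else \<mu>) +
        (if j = 1 then P $$ (i, 0) * a else 0) =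
      (if i = 0 then a else if i = 1 then 1 else \<mu>) * P $$ (i, j) +
        (if i = 0 then a * P $$ (1, j) else 0)" if "i < n" "j < n" for i j
    using arg_cong[OF cmat_exp_commute[OF P], of "\<lambda>Q. Q $$ (i, j)"]
    unfolding exp_P mult_coupled_diag_index[OF P n that] coupled_diag_mult_index[OF P n that] .
  have P10: "P $$ (1, 0) = 0"
    using comm[of 0 0] n a by simp
  have "P $$ (i, 0) = 0" if "i < n" "i \<noteq> 0" for i
    using comm[of i 0] n a P10 that by (cases "i = 1") auto
  then have "cmat_exp P $$ (0, 0) = exp (P $$ (0, 0))"
    using n by (subst cmat_exp_eigencolumn[OF P]) auto
  then show "exp (P $$ (0, 0)) = a"
    using n by (simp add: exp_P coupled_diag_index)
  have "P $$ (1, j) = 0" if "j < n" "j \<noteq> 1" for j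
    using comm[of 1 j] n \<mu> P10 that by (cases "j = 0") auto
  then have "cmat_exp P $$ (1, 1) = exp (P $$ (1, 1))"
    using n by (subst cmat_exp_eigenrow[OF P]) auto
  then show "exp (P $$ (1, 1)) = 1"
    using n by (simp add: exp_P coupled_diag_index)
  show "P $$ (0, 0) = P $$ (1, 1)" if "a = 1"
    using comm[of 0 1] n that by simp
qed

section \<open>Evaluating matrices of functions at a point\<close>

text \<open>Evaluation at a point is a ring homomorphism, so it passes through matrix products and
  powers, and the exponential over the ring of functions reduces to that of complex matrices.\<close>

interpretation point_evaluation: semiring_hom "\<lambda>f::'a \<Rightarrow> complex. f x" for x
  by unfold_locales (auto simp: zero_fun_def one_fun_def plus_fun_def times_fun_def)

lemma map_mat_eval_mat_exp:
  assumes A: "A \<in> carrier_mat n n"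
  shows "map_mat (\<lambda>f. f x) (mat_exp A) = cmat_exp (map_mat (\<lambda>f. f x) A)"
proof (rule eq_matI)
  fix i j
  assume "i < dim_row (cmat_exp (map_mat (\<lambda>f. f x) A))" "j < dim_col (cmat_exp (map_mat (\<lambda>f. f x) A))"
  then have ij: "i < n" "j < n" using A by (auto simp: cmat_exp_def)
  have "(map_mat (\<lambda>f. f x) A ^\<^sub>m k) $$ (i, j) = ((A ^\<^sub>m k) $$ (i, j)) x" for k
    using A ij pow_carrier_mat[OF A, of k] by (simp flip: point_evaluation.mat_hom_pow[OF A])
  then show "map_mat (\<lambda>f. f x) (mat_exp A) $$ (i, j) = cmat_exp (map_mat (\<lambda>f. f x) A) $$ (i, j)"
    using A ij by (simp add: mat_exp_def cmat_exp_def)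
qed (use A in \<open>auto simp: mat_exp_def cmat_exp_def\<close>)

lemma map_mat_eval_coupled_diag:
  "map_mat (\<lambda>f. f x) (coupled_diag n d a) = coupled_diag n (\<lambda>i. d i x) (a x)"
  by (rule eq_matI) (auto simp: coupled_diag_def)

lemma mat_exp_carrier: "A \<in> carrier_mat n n \<Longrightarrow> mat_exp A \<in> carrier_mat n n"
  by (auto simp: mat_exp_def)

lemma eval_mat_exp_product:
  assumes n: "n \<ge> 2" and d1: "d 1 x = 0"
  shows "map_mat (\<lambda>f. f x) (mat_exp (coupled_diag n d 0) * mat_exp (coupled_diag n (\<lambda>_. 0) 1)) =
    coupled_diag n (\<lambda>i. exp (d i x)) (exp (d 0 x))"
proof -
  have "map_mat (\<lambda>f. f x) (mat_exp (coupled_diag n d 0) * mat_exp (coupled_diag n (\<lambda>_. 0) 1)) =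
      cmat_exp (coupled_diag n (\<lambda>i. d i x) 0) * cmat_exp (coupled_diag n (\<lambda>_. 0) 1)"
    by (simp add: point_evaluation.mat_hom_mult[OF mat_exp_carrier[OF coupled_diag_carrier]
          mat_exp_carrier[OF coupled_diag_carrier]]
        map_mat_eval_mat_exp[of _ n] map_mat_eval_coupled_diag)
  also have "\<dots> = coupled_diag n (\<lambda>i. exp (d i x)) 0 * coupled_diag n (\<lambda>_. 1) 1"
    using n by (simp add: cmat_exp_diag cmat_exp_elementary)
  also have "\<dots> = coupled_diag n (\<lambda>i. exp (d i x)) (exp (d 0 x))"
  proof (rule eq_matI)
    fix i j assume "i < dim_row (coupled_diag n (\<lambda>i. exp (d i x)) (exp (d 0 x)))"
      "j < dim_col (coupled_diag n (\<lambda>i. exp (d i x)) (exp (d 0 x)))"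
    then have "i < n" "j < n" by (auto simp: coupled_diag_def)
    then show "(coupled_diag n (\<lambda>i. exp (d i x)) 0 * coupled_diag n (\<lambda>_. 1) 1) $$ (i, j) =
        coupled_diag n (\<lambda>i. exp (d i x)) (exp (d 0 x)) $$ (i, j)"
      using n by (simp add: mult_coupled_diag_index coupled_diag_index del: index_mult_mat)
  qed (auto simp: coupled_diag_def)
  finally show ?thesis .
qed

section \<open>Continuous logarithms and arcs in charts\<close>

text \<open>The difference takes values in \<open>2 \<pi> \<i> \<int>\<close>, a set whose distinct points have distance at
  least \<open>2 \<pi>\<close>.\<close>

lemma continuous_logarithms_differ_by_constant:
  fixes f g :: "'a::topological_space \<Rightarrow> complex"
  assumes K: "connected K" and f: "continuous_on K f" and g: "continuous_on K g"
    and eq: "\<And>x. x \<in> K \<Longrightarrow> exp (f x) = exp (g x)"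
    and pq: "p \<in> K" "q \<in> K"
  shows "f p - g p = f q - g q"
proof -
  have "(\<lambda>x. f x - g x) constant_on K"
  proof (rule continuous_discrete_range_constant[OF K])
    show "continuous_on K (\<lambda>x. f x - g x)"
      using f g by (intro continuous_intros)
    fix x assume x: "x \<in> K"
    have "2 * pi \<le> norm (f y - g y - (f x - g x))"
      if y: "y \<in> K" "f y - g y \<noteq> f x - g x" for y
    proof (rule ccontr)
      assume "\<not> ?thesis"
      then have "norm ((f y - g y) - (f x - g x)) < 2 * pi" by simp
      then have "\<bar>Im (f y - g y) - Im (f x - g x)\<bar> < 2 * pi"
        by (metis abs_Im_le_cmod minus_complex.simps(2) order_le_less_trans)
      moreover have "exp (f y - g y) = exp (f x - g x)"
        using eq[OF x] eq[OF y(1)] by (simp add: exp_diff)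
      ultimately show False using y(2) exp_complex_eqI by blast
    qed
    then show "\<exists>e>0. \<forall>y. y \<in> K \<and> f y - g y \<noteq> f x - g x \<longrightarrow> e \<le> norm (f y - g y - (f x - g x))"
      by (intro exI[of _ "2 * pi"]) auto
  qed
  then show ?thesis using pq unfolding constant_on_def by metis
qed

text \<open>The image in the space of a short real segment in the direction of coordinate 0, which is a
  coordinate of the chart because \<open>d > 0\<close>.\<close>

lemma connected_compact_pair_in_chart:
  fixes \<O> :: "('a::topological_space) structure_sheaf"
  assumes x: "smooth_point \<O> d x" and d: "d > 0"
  obtains K :: "'a set" and p q where "compact K" "connected K" "p \<in> K" "q \<in> K" "p \<noteq> q"
proof -
  obtain U D \<phi> \<psi> where xU: "x \<in> U" and D: "open_in_Cn d D" and hom: "homeomorphism U D \<phi> \<psi>"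
    using x unfolding smooth_point_def model_iso_def by blast
  obtain T where T: "open T" "D = Cn d \<inter> T"
    using D unfolding open_in_Cn_def openin_open by blast
  define z where "z = \<phi> x"
  have z: "z \<in> D" using hom xU unfolding z_def homeomorphism_def by blast
  define \<gamma> :: "real \<Rightarrow> nat \<Rightarrow> complex" where
    "\<gamma> = (\<lambda>s i. z i + (if i = 0 then complex_of_real s else 0))"
  have cont: "continuous_on UNIV \<gamma>"
    unfolding \<gamma>_def
  proof (rule continuous_on_coordinatewise_then_product)
    show "continuous_on UNIV (\<lambda>s. z i + (if i = 0 then complex_of_real s else 0))" for i
      by (cases "i = 0") (auto intro!: continuous_intros)
  qed
  have "open (\<gamma> -` T)" using cont T(1) by (simp add: open_vimage)
  moreover have "\<gamma> 0 = z" by (auto simp: \<gamma>_def)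
  then have "0 \<in> \<gamma> -` T" using z T by simp
  ultimately obtain e where e: "e > 0" "cball 0 e \<subseteq> \<gamma> -` T"
    using open_contains_cball by blast
  have sub: "\<gamma> ` {0..e} \<subseteq> D"
  proof -
    have "\<gamma> s \<in> Cn d" for s using z T d by (auto simp: Cn_def \<gamma>_def)
    moreover have "\<gamma> s \<in> T" if "s \<in> {0..e}" for s using e that by (auto simp: subset_iff)
    ultimately show ?thesis using T by auto
  qed
  have \<psi>: "continuous_on (\<gamma> ` {0..e}) \<psi>"
    using hom sub unfolding homeomorphism_def by (auto intro: continuous_on_subset)
  have \<gamma>: "continuous_on {0..e} \<gamma>" using cont continuous_on_subset by blast
  have "\<psi> (\<gamma> 0) \<noteq> \<psi> (\<gamma> e)"
  proof
    assume "\<psi> (\<gamma> 0) = \<psi> (\<gamma> e)"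
    moreover have "\<gamma> 0 \<in> D" "\<gamma> e \<in> D" using sub e by auto
    ultimately have "\<gamma> 0 = \<gamma> e" using hom unfolding homeomorphism_def by metis
    then have "\<gamma> 0 0 = \<gamma> e 0" by simp
    then show False using e by (simp add: \<gamma>_def)
  qed
  moreover have "compact (\<psi> ` \<gamma> ` {0..e})"
    by (intro compact_continuous_image \<psi> \<gamma> compact_Icc)
  moreover have "connected (\<psi> ` \<gamma> ` {0..e})"
    by (intro connected_continuous_image \<psi> \<gamma> connected_Icc)
  ultimately show thesis
    using that[of "\<psi> ` \<gamma> ` {0..e}" "\<psi> (\<gamma> 0)" "\<psi> (\<gamma> e)"] e by auto
qed

section \<open>The lower bound\<close>

lemma product_of_exps_0: "product_of_exps n R 0 M \<longleftrightarrow> M = 1\<^sub>m n"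
  by (simp add: product_of_exps_def)

lemma product_of_exps_1:
  "product_of_exps n R (Suc 0) M \<longleftrightarrow> (\<exists>C \<in> mat_over n R. M = mat_exp C)"
proof -
  have "mat_exp C * 1\<^sub>m n = mat_exp C" if "C \<in> mat_over n R" for C
    using that mat_exp_carrier[of C n] right_mult_one_mat[of "mat_exp C" n n]
    by (simp add: mat_over_def)
  moreover have "(\<exists>As. length As = Suc 0 \<and> Q As) \<longleftrightarrow> (\<exists>C. Q [C])"
    for Q :: "('a \<Rightarrow> complex) mat list \<Rightarrow> bool"
    by (metis length_0_conv length_Suc_conv list.size(3,4) add.right_neutral add_Suc_right)
  ultimately show ?thesis
    unfolding product_of_exps_def by auto
qed

lemma mat_exp_mult_in_Exp_group:
  assumes "A \<in> mat_over n R" "B \<in> mat_over n R"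
  shows "mat_exp A * mat_exp B \<in> Exp_group n R"
  using generate.eng[of "mat_exp A" "GL_over n R" "mat_exp ` mat_over n R" "mat_exp B"] assms
  by (auto simp: Exp_group_def GL_over_def units_of_def intro: generate.incl)

text \<open>\<open>R\<close> is an algebra of continuous functions, one of which is not constant on some compact
  connected set. The matrix \<open>M\<close> of the proof lies in \<open>Exp_group n R\<close> as a product of two of its generators, and
  the two claims about it exclude the lengths 0 and 1.\<close>

lemma exp_number_ge_2:
  fixes R :: "('a::topological_space \<Rightarrow> complex) set"
  assumes cont: "\<And>f. f \<in> R \<Longrightarrow> continuous_on UNIV f"
    and const: "\<And>c. (\<lambda>_. c) \<in> R"
    and add: "\<And>f g. f \<in> R \<Longrightarrow> g \<in> R \<Longrightarrow> f + g \<in> R"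
    and mult: "\<And>f g. f \<in> R \<Longrightarrow> g \<in> R \<Longrightarrow> f * g \<in> R"
    and K: "compact K" "connected K" and pq: "p \<in> K" "q \<in> K"
    and h: "h \<in> R" "h p \<noteq> h q"
    and n: "n \<ge> 2"
  shows "exp_number n R \<ge> 2"
proof -
  define g where "g = (h + (\<lambda>_. - h p)) * (\<lambda>_. 2 * pi * \<i> / (h q - h p))"
  have gR: "g \<in> R" unfolding g_def by (intro add mult const h)
  have gp: "g p = 0" and gq: "g q = 2 * pi * \<i>"
    using h by (auto simp: g_def)
  have "continuous_on K g" using cont[OF gR] continuous_on_subset by blast
  then have "bounded (g ` K)"
    by (intro compact_imp_bounded compact_continuous_image K)
  then obtain b where b: "b > 0" "\<And>x. x \<in> K \<Longrightarrow> norm (g x) \<le> b"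
    unfolding bounded_pos by auto
  \<comment> \<open>The modulus of \<open>exp c\<close> exceeds 1 and the moduli of all \<open>exp (g x)\<close> with \<open>x \<in> K\<close>.\<close>
  define c where "c = complex_of_real (b + 1)"
  define d where "d = (\<lambda>i::nat. if i = 0 then g else if i = 1 then 0 else (\<lambda>_. c))"
  define M where "M = mat_exp (coupled_diag n d 0) * mat_exp (coupled_diag n (\<lambda>_. 0) 1)"
  have eval_M: "map_mat (\<lambda>f. f x) M =
      coupled_diag n (\<lambda>i. if i = 0 then exp (g x) else if i = 1 then 1 else exp c) (exp (g x))" for x
  proof -
    have "map_mat (\<lambda>f. f x) M = coupled_diag n (\<lambda>i. exp (d i x)) (exp (d 0 x))"
      unfolding M_def by (rule eval_mat_exp_product[OF n]) (simp add: d_def)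
    also have "(\<lambda>i. exp (d i x)) = (\<lambda>i. if i = 0 then exp (g x) else if i = 1 then 1 else exp c)"
      by (auto simp: d_def)
    finally show ?thesis by (simp add: d_def)
  qed
  have const': "0 \<in> R" "1 \<in> R" using const[of 0] const[of 1] by (simp_all add: zero_fun_def one_fun_def)
  have dR: "d i \<in> R" for i using gR const const' by (simp add: d_def)
  have M_in: "M \<in> Exp_group n R"
    unfolding M_def using dR const'
    by (intro mat_exp_mult_in_Exp_group)
      (auto simp: mat_over_def coupled_diag_def elements_mat_def)
  \<comment> \<open>The coupling entry \<open>exp (g p)\<close> is nonzero, so \<open>M\<close> is not the identity matrix.\<close>
  have not_0: "\<not> product_of_exps n R 0 M"
  proof
    assume "product_of_exps n R 0 M"
    then have "map_mat (\<lambda>f. f p) M $$ (0, 1) = 0"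
      using n by (simp add: product_of_exps_0)
    then show False unfolding eval_M using n by (simp add: coupled_diag_index)
  qed
  have not_1: "\<not> product_of_exps n R 1 M"
  proof
    assume "product_of_exps n R 1 M"
    then obtain C where C: "C \<in> mat_over n R" and MC: "M = mat_exp C"
      by (auto simp: product_of_exps_1)
    have Cc: "C \<in> carrier_mat n n" using C by (simp add: mat_over_def)
    have CR: "C $$ (i, j) \<in> R" if "i < n" "j < n" for i j
      using C that unfolding mat_over_def by (auto intro: elements_matI)
    have ne: "exp (g x) \<noteq> exp c" "exp c \<noteq> 1" if "x \<in> K" for x
    proof -
      have "Re (g x) < b + 1" using b(2)[OF that] complex_Re_le_cmod[of "g x"] by linarith
      then have "norm (exp (g x)) < norm (exp c)" by (simp add: c_def)
      then show "exp (g x) \<noteq> exp c" by (metis less_irrefl)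
      have "1 < norm (exp c)" using b by (simp add: c_def)
      then show "exp c \<noteq> 1" by (metis less_irrefl norm_one)
    qed
    have diag: "exp ((C $$ (0, 0)) x) = exp (g x)" "exp ((C $$ (1, 1)) x) = exp 0"
      "exp (g x) = 1 \<Longrightarrow> (C $$ (0, 0)) x = (C $$ (1, 1)) x" if "x \<in> K" for x
    proof -
      have "cmat_exp (map_mat (\<lambda>f. f x) C) =
          coupled_diag n (\<lambda>i. if i = 0 then exp (g x) else if i = 1 then 1 else exp c) (exp (g x))"
        using eval_M[of x] unfolding MC map_mat_eval_mat_exp[OF Cc] .
      note log = logarithm_of_coupled_diag[OF _ n this exp_not_eq_zero ne[OF that]]
      have "map_mat (\<lambda>f. f x) C \<in> carrier_mat n n" using Cc by simp
      note log = log[OF this]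
      show "exp ((C $$ (0, 0)) x) = exp (g x)" "exp ((C $$ (1, 1)) x) = exp 0"
        "exp (g x) = 1 \<Longrightarrow> (C $$ (0, 0)) x = (C $$ (1, 1)) x"
        using log n Cc by simp_all
    qed
    have contK: "continuous_on K f" if "f \<in> R" for f using cont[OF that] continuous_on_subset by blast
    have "(C $$ (0, 0)) p - g p = (C $$ (0, 0)) q - g q"
      using n by (intro continuous_logarithms_differ_by_constant[OF K(2) _ _ diag(1) pq] contK CR gR) auto
    moreover have "(C $$ (1, 1)) p - 0 = (C $$ (1, 1)) q - 0"
      using n by (intro continuous_logarithms_differ_by_constant[OF K(2) _ _ diag(2) pq] contK CR const) auto
    moreover have "exp (g p) = 1" "exp (g q) = 1"
      unfolding gp gq using exp_two_pi_i by simp_all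
    then have "(C $$ (0, 0)) p = (C $$ (1, 1)) p" "(C $$ (0, 0)) q = (C $$ (1, 1)) q"
      using diag(3)[OF pq(1)] diag(3)[OF pq(2)] by blast+
    ultimately show False by (simp add: gp gq)
  qed
  have "2 \<le> enat m" if "\<forall>M \<in> Exp_group n R. product_of_exps n R m M" for m
  proof -
    have "product_of_exps n R m M" using that M_in by (rule bspec)
    then have "m \<noteq> 0" "m \<noteq> 1" using not_0 not_1 by metis+
    then show ?thesis by (simp add: numeral_eq_enat)
  qed
  then show ?thesis unfolding exp_number_def by (intro Inf_greatest) blast
qed

theorem proposition4p4:
  fixes \<O> :: "('a::{t2_space,second_countable_topology}) structure_sheaf"
    and n :: nat
  assumes "reduced_stein_space \<O>"
    and "complex_dim \<O> > 0"
    and "n \<ge> 2"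
  shows "exp_number n (\<O> UNIV) \<ge> 2"
proof -
  have sheaf: "function_sheaf \<O>"
    using assms(1) unfolding reduced_stein_space_def reduced_complex_space_def by blast
  obtain d x where "smooth_point \<O> d x" "d > 0"
    using assms(2) unfolding complex_dim_def less_Sup_iff by (auto simp: zero_enat_def)
  then obtain K and p q :: 'a where K: "compact K" "connected K" "p \<in> K" "q \<in> K" and "p \<noteq> q"
    by (rule connected_compact_pair_in_chart)
  then obtain h where "h \<in> \<O> UNIV" "h p \<noteq> h q"
    using assms(1) unfolding reduced_stein_space_def by blast
  moreover have "continuous_on UNIV f" if "f \<in> \<O> UNIV" for f
    using sheaf[unfolded function_sheaf_def, THEN conjunct2, THEN conjunct1] that by simp
  moreover have "(\<lambda>_. c) \<in> \<O> UNIV"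
    "f \<in> \<O> UNIV \<Longrightarrow> g \<in> \<O> UNIV \<Longrightarrow> f + g \<in> \<O> UNIV"
    "f \<in> \<O> UNIV \<Longrightarrow> g \<in> \<O> UNIV \<Longrightarrow> f * g \<in> \<O> UNIV" for c f g
    using sheaf[unfolded function_sheaf_def, THEN conjunct2, THEN conjunct2, THEN conjunct1,
        rule_format, OF open_UNIV] by blast+
  ultimately show ?thesis
    using exp_number_ge_2[of "\<O> UNIV" K p q h n] K assms(3) by blast
qed

end
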